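(* Let $m_s<m_r$ be positive integers and let $q_s=\lceil (m_s+1)/2\rceil$ and $q_r=\lceil (m_r+1)/2\rceil$. Consider the bicameral simple game with $m_s$ senators, $m_r$ representatives and quotas $q_s,q_r$. In each of the following cases, $c_s(k)>c_r(k)$ for all $k$ such that $c_s(k)\neq 0$: (i) $m_s$ and $m_r$ are both odd; (ii) $m_s$ and $m_r$ are both even; (iii) $m_s$ is even and $m_r$ is odd; (iv) $m_s$ is odd, $m_r$ is even, and $m_r>2m_s$. Thus in these cases, for a senator $S$ and a representative $R$, $\Phi(S)>\Phi(R)$ for any power index $\Phi$ that does not assign power $0$ to both $S$ and $R$.
   Context: The bicameral simple game with $m_s$ senators, $m_r$ representatives and quotas $q_s,q_r$ ($1\le q_s\le m_s$, $1\le q_r\le m_r$) has as players the $n=m_s+m_r$ elements of the disjoint union of a set of $m_s$ senators and a set of $m_r$ representatives; a coalition (set of players) is winning iff it contains at least $q_s$ senators and at least $q_r$ representatives (so the minimal winning coalitions are those with exactly $q_s$ senators and $q_r$ representatives). A player $i$ in a coalition $T$ is critical in $T$ if $T$ is winning and $T\setminus\{i\}$ is not. For a player $i$ and an integer $k$, $c_i(k)$ is the number of coalitions of size $k$ in which $i$ is critical. By symmetry this number is the same for all senators, and is denoted $c_s(k)$; likewise $c_r(k)$ denotes it for a representative. A power index $\Phi$ on a game with $n$ players is given by a weighting vector $(\lambda_1,\dots,\lambda_n)$ with $\lambda_k\ge 0$ for all $k$ and $\sum_{k=1}^n\lambda_k\binom{n-1}{k-1}=1$; the $\Phi$-power of player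 $i$ is $\Phi(i)=\sum_{k=1}^n\lambda_k c_i(k)$. *)

theory Defs
  imports Complex_Main
begin

text \<open>A simple game is given by its set \<open>N\<close> of players together with the set \<open>W\<close> of its winning
  coalitions, which are subsets of \<open>N\<close>.\<close>

definition bicameral_winning :: "'a set \<Rightarrow> 'a set \<Rightarrow> nat \<Rightarrow> nat \<Rightarrow> 'a set set" where
  "bicameral_winning Sen Rep q\<^sub>s q\<^sub>r =
     {T. T \<subseteq> Sen \<union> Rep \<and> card (T \<inter> Sen) \<ge> q\<^sub>s \<and> card (T \<inter> Rep) \<ge> q\<^sub>r}"

definition critical :: "'a set set \<Rightarrow> 'a \<Rightarrow> 'a set \<Rightarrow> bool" where
  "critical W i T \<longleftrightarrow> i \<in> T \<and> T \<in> W \<and> T - {i} \<notin> W"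

definition critical_count :: "'a set \<Rightarrow> 'a set set \<Rightarrow> 'a \<Rightarrow> nat \<Rightarrow> nat" where
  "critical_count N W i k = card {T. T \<subseteq> N \<and> card T = k \<and> critical W i T}"

text \<open>Only the values at \<open>1, \<dots>, n\<close> of a weighting vector are used.\<close>

definition weighting_vector :: "nat \<Rightarrow> (nat \<Rightarrow> real) \<Rightarrow> bool" where
  "weighting_vector n w \<longleftrightarrow>
     (\<forall>k\<in>{1..n}. w k \<ge> 0) \<and> (\<Sum>k = 1..n. w k * real ((n - 1) choose (k - 1))) = 1"

definition power_index :: "(nat \<Rightarrow> real) \<Rightarrow> 'a set \<Rightarrow> 'a set set \<Rightarrow> 'a \<Rightarrow> real" where
  "power_index w N W i = (\<Sum>k = 1..card N. w k * real (critical_count N W i k))"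

end

theory Submission
  imports Defs
begin

text \<open>A senator is critical in a winning coalition iff the coalition has exactly \<open>q\<^sub>s\<close> senators, so
  both counts are products of two binomial coefficients. Write \<open>m = p + q\<close> in each chamber and
  \<open>k = q\<^sub>s + q\<^sub>r + j\<close>. Dividing by the binomial coefficients at \<open>j = 0\<close>, the claim for \<open>j = 0\<close> is
  \<open>q\<^sub>r / m\<^sub>r < q\<^sub>s / m\<^sub>s\<close>, that is \<open>q\<^sub>r p\<^sub>s < q\<^sub>s p\<^sub>r\<close>, and passing from \<open>j\<close> to \<open>j + 1\<close> multiplies the
  two sides by \<open>(p - j) / (q + j + 1)\<close>, which is not smaller for the representatives' chamber. Majority
  quotas satisfy \<open>q\<^sub>r p\<^sub>s < q\<^sub>s p\<^sub>r\<close> in each of the four parity cases.\<close>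

lemma bicameral_winning_commute:
  "bicameral_winning A B p q = bicameral_winning B A q p"
  unfolding bicameral_winning_def by (auto simp: Un_commute)

text \<open>Removing \<open>a\<close> lowers only the \<open>A\<close>-count, by one, so winning is
  lost exactly when that count sits at its quota. \<open>A\<close> may be either chamber;
  \<open>bicameral_winning_commute\<close> exchanges them.\<close>

lemma critical_bicameral_iff:
  assumes "finite A" and "A \<inter> B = {}" and "a \<in> A"
  shows "critical (bicameral_winning A B p q) a T \<longleftrightarrow>
    a \<in> T \<and> T \<subseteq> A \<union> B \<and> card (T \<inter> A) = p \<and> q \<le> card (T \<inter> B)"
proof (cases "a \<in> T")
  case True
  have B: "(T - {a}) \<inter> B = T \<inter> B" using assms by auto
  have "(T - {a}) \<inter> A = T \<inter> A - {a}" by auto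
  moreover have "a \<in> T \<inter> A" "finite (T \<inter> A)" using True assms by auto
  ultimately have "card (T \<inter> A) = Suc (card ((T - {a}) \<inter> A))"
    by (metis card_Suc_Diff1)
  then show ?thesis
    unfolding critical_def bicameral_winning_def using True B by auto
qed (simp add: critical_def)

lemma critical_count_bicameral:
  assumes fin: "finite A" "finite B" and disj: "A \<inter> B = {}" and a: "a \<in> A" and "0 < p"
  shows "critical_count (A \<union> B) (bicameral_winning A B p q) a k =
    (if p + q \<le> k then ((card A - 1) choose (p - 1)) * (card B choose (k - p)) else 0)"
proof -
  let ?S = "{T. T \<subseteq> A \<union> B \<and> card T = k \<and> critical (bicameral_winning A B p q) a T}"
  have card_T: "card T = card (T \<inter> A) + card (T \<inter> B)" if "T \<subseteq> A \<union> B" for T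
  proof -
    have "T = (T \<inter> A) \<union> (T \<inter> B)" using that by auto
    moreover have "card ((T \<inter> A) \<union> (T \<inter> B)) = card (T \<inter> A) + card (T \<inter> B)"
      using fin disj by (intro card_Un_disjoint) auto
    ultimately show ?thesis by simp
  qed
  \<comment> \<open>Once the \<open>A\<close>-part has \<open>p\<close> members, the size fixes the
    \<open>B\<close>-part, and its quota becomes \<open>p + q \<le> k\<close>, which also makes
    \<open>k - p\<close> an exact subtraction.\<close>
  have S: "?S = {T. T \<subseteq> A \<union> B \<and> a \<in> T \<and> card (T \<inter> A) = p \<and> card (T \<inter> B) = k - p \<and> p + q \<le> k}"
    using critical_bicameral_iff[OF fin(1) disj a] card_T by auto
  show ?thesis
  proof (cases "p + q \<le> k")
    case False
    then show ?thesis unfolding critical_count_def S by simp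
  next
    case True
    let ?P = "{X. X \<subseteq> A - {a} \<and> card X = p - 1}" and ?Q = "{Y. Y \<subseteq> B \<and> card Y = k - p}"
    \<comment> \<open>Such a coalition is a free choice of \<open>p - 1\<close> colleagues of
      \<open>a\<close> and of \<open>k - p\<close> members of \<open>B\<close>.\<close>
    have "bij_betw (\<lambda>(X, Y). insert a X \<union> Y) (?P \<times> ?Q) ?S"
    proof (rule bij_betw_byWitness[where f' = "\<lambda>T. (T \<inter> A - {a}, T \<inter> B)"])
      show "\<forall>x\<in>?P \<times> ?Q. (\<lambda>T. (T \<inter> A - {a}, T \<inter> B)) ((\<lambda>(X, Y). insert a X \<union> Y) x) = x"
        using disj a by auto
      show "\<forall>T\<in>?S. (\<lambda>(X, Y). insert a X \<union> Y) ((\<lambda>T. (T \<inter> A - {a}, T \<inter> B)) T) = T"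
        unfolding S using a by auto
      show "(\<lambda>(X, Y). insert a X \<union> Y) ` (?P \<times> ?Q) \<subseteq> ?S"
      proof clarify
        fix X Y assume X: "X \<subseteq> A - {a}" "card X = p - 1" and Y: "Y \<subseteq> B" "card Y = k - p"
        have "(insert a X \<union> Y) \<inter> A = insert a X" "(insert a X \<union> Y) \<inter> B = Y"
          using X Y a disj by auto
        moreover have "finite X" "a \<notin> X" using X fin finite_subset by auto
        then have "card (insert a X) = p" using X \<open>0 < p\<close> by simp
        ultimately have "insert a X \<union> Y \<in> ?S"
          unfolding S using True X Y a by auto
        then show "insert a X \<union> Y \<subseteq> A \<union> B \<and> card (insert a X \<union> Y) = k \<and>
            critical (bicameral_winning A B p q) a (insert a X \<union> Y)" by blast
      qed
      show "(\<lambda>T. (T \<inter> A - {a}, T \<inter> B)) ` ?S \<subseteq> ?P \<times> ?Q"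
        unfolding S using a fin by auto
    qed
    then have "card (?P \<times> ?Q) = card ?S" by (rule bij_betw_same_card)
    then have "card ?S = card ?P * card ?Q" by (simp only: card_cartesian_product)
    then show ?thesis
      unfolding critical_count_def using True fin a by (simp add: n_subsets)
  qed
qed

text \<open>Here \<open>p1\<close>, \<open>p2\<close> count the members beyond the quota, and
  \<open>j\<close> the players beyond a minimal winning coalition. The bound
  \<open>j \<le> p2\<close> keeps the right-hand side positive, so that strictness is
  possible.\<close>

lemma binomial_product_less:
  fixes p1 q1 p2 q2 j :: nat
  assumes q: "0 < q1" "q1 \<le> q2" and less: "q2 * p1 < q1 * p2" and "j \<le> p2"
  shows "((p2 + q2 - 1) choose (q2 - 1)) * ((p1 + q1) choose (q1 + j)) <
         ((p1 + q1 - 1) choose (q1 - 1)) * ((p2 + q2) choose (q2 + j))"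
  using \<open>j \<le> p2\<close>
proof (induction j)
  case 0
  let ?X1 = "(p1 + q1 - 1) choose (q1 - 1)" and ?X2 = "(p2 + q2 - 1) choose (q2 - 1)"
  have step: "q * ((p + q) choose q) = (p + q) * ((p + q - 1) choose (q - 1))"
    if "0 < q" for p q :: nat
    using that Suc_times_binomial_eq[of "p + q - 1" "q - 1"] by (simp add: mult.commute)
  have pos: "0 < ?X1 * ?X2" using q by (auto simp: zero_less_binomial_iff)
  \<comment> \<open>After multiplication by \<open>q1 * q2\<close>, absorption turns both sides into
    multiples of \<open>?X1 * ?X2\<close>, whose coefficients differ by \<open>less\<close>
    alone.\<close>
  have "q1 * q2 * (?X2 * ((p1 + q1) choose q1)) = ?X2 * q2 * (q1 * ((p1 + q1) choose q1))"
    by (simp add: ac_simps)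
  also have "\<dots> = (q2 * p1 + q2 * q1) * (?X1 * ?X2)"
    using step[of q1 p1] q by (simp add: algebra_simps)
  also have "\<dots> < (q1 * p2 + q2 * q1) * (?X1 * ?X2)"
    using pos less by (intro mult_strict_right_mono) auto
  also have "\<dots> = ?X1 * q1 * (q2 * ((p2 + q2) choose q2))"
    using step[of q2 p2] q by (simp add: algebra_simps)
  also have "\<dots> = q1 * q2 * (?X1 * ((p2 + q2) choose q2))"
    by (simp add: ac_simps)
  finally show ?case by simp
next
  case (Suc j)
  let ?X1 = "(p1 + q1 - 1) choose (q1 - 1)" and ?X2 = "(p2 + q2 - 1) choose (q2 - 1)"
  let ?B = "\<lambda>j. (p1 + q1) choose (q1 + j)" and ?C = "\<lambda>j. (p2 + q2) choose (q2 + j)"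
  have IH: "?X2 * ?B j < ?X1 * ?C j" using Suc by simp
  \<comment> \<open>For \<open>p \<le> j\<close> both sides are 0, because the subtraction
    truncates.\<close>
  have step: "(q + j + 1) * ((p + q) choose (q + Suc j)) = (p - j) * ((p + q) choose (q + j))"
    for p q :: nat
    using binomial_absorb_comp[of "p + q" "q + j"] binomial_absorption[of "q + j" "p + q"]
    by (simp add: ac_simps)
  have pos: "0 < ?X1 * ?C (Suc j)" using q Suc.prems by (auto simp: zero_less_binomial_iff)
  show ?case
  proof (cases "j < p1")
    case False
    then show ?thesis using pos by (simp add: binomial_eq_0)
  next
    case True
    have "q1 * p1 \<le> q2 * p1" using q by simp
    then have "p1 < p2" using less by (metis le_less_trans mult_less_cancel1)
    have ratio: "(p1 - j) * (q2 + j + 1) \<le> (p2 - j) * (q1 + j + 1)"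
    proof -
      \<comment> \<open>Over the integers the products expand freely; the inequality is the sum of
        the three bounds on \<open>q2 * p1\<close>, \<open>p1 * (j + 1)\<close> and
        \<open>j * q1\<close>.\<close>
      have "int p1 * (int q2 + int j + 1) - int j * (int q2 + int j + 1)
          \<le> int p2 * (int q1 + int j + 1) - int j * (int q1 + int j + 1)"
      proof -
        have "int q2 * int p1 < int q1 * int p2" using less by (metis of_nat_less_iff of_nat_mult)
        moreover have "int p1 * (int j + 1) \<le> int p2 * (int j + 1)"
          using \<open>p1 < p2\<close> by (intro mult_right_mono) auto
        moreover have "int j * int q1 \<le> int j * int q2"
          using q by (intro mult_left_mono) auto
        ultimately show ?thesis by (simp add: algebra_simps)
      qed
      then have "int ((p1 - j) * (q2 + j + 1)) \<le> int ((p2 - j) * (q1 + j + 1))"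
        using True Suc.prems
        by (simp only: of_nat_mult of_nat_diff less_imp_le Suc_leD) (simp add: algebra_simps)
      then show ?thesis by (simp only: of_nat_le_iff)
    qed
    \<comment> \<open>The denominators of the two ratios between consecutive binomials, multiplied
      together to avoid division.\<close>
    let ?d = "(q1 + j + 1) * (q2 + j + 1)"
    have "?d * (?X2 * ?B (Suc j)) = ?X2 * (q2 + j + 1) * ((q1 + j + 1) * ?B (Suc j))"
      by (simp only: ac_simps)
    also have "\<dots> = ?X2 * (q2 + j + 1) * ((p1 - j) * ?B j)"
      by (simp only: step)
    also have "\<dots> = ((p1 - j) * (q2 + j + 1)) * (?X2 * ?B j)"
      by (simp only: ac_simps)
    also have "\<dots> < ((p1 - j) * (q2 + j + 1)) * (?X1 * ?C j)"
      using True IH by (intro mult_strict_left_mono) auto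
    also have "\<dots> \<le> ((p2 - j) * (q1 + j + 1)) * (?X1 * ?C j)"
      using ratio by (rule mult_right_mono) simp
    also have "\<dots> = ?X1 * (q1 + j + 1) * ((p2 - j) * ?C j)"
      by (simp only: ac_simps)
    also have "\<dots> = ?X1 * (q1 + j + 1) * ((q2 + j + 1) * ?C (Suc j))"
      by (simp only: step)
    also have "\<dots> = ?d * (?X1 * ?C (Suc j))"
      by (simp only: ac_simps)
    finally show ?thesis by (simp only: mult_less_cancel1)
  qed
qed

text \<open>The second alternative covers sizes that are too small to win or too large for anyone to
  be critical. Recording that both counts vanish there is what comparing power indices
  requires.\<close>

lemma critical_count_bicameral_less:
  assumes fin: "finite A" "finite B" and disj: "A \<inter> B = {}" and ab: "a \<in> A" "b \<in> B"
    and card: "card A = p1 + q1" "card B = p2 + q2"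
    and q: "0 < q1" "q1 \<le> q2" and less: "q2 * p1 < q1 * p2"
  defines "W \<equiv> bicameral_winning A B q1 q2"
  shows "critical_count (A \<union> B) W b k < critical_count (A \<union> B) W a k \<or>
    critical_count (A \<union> B) W b k = 0 \<and> critical_count (A \<union> B) W a k = 0"
proof -
  have a: "critical_count (A \<union> B) W a k = (if q1 + q2 \<le> k
      then ((p1 + q1 - 1) choose (q1 - 1)) * ((p2 + q2) choose (k - q1)) else 0)"
    unfolding W_def by (subst critical_count_bicameral) (use assms in auto)
  have "W = bicameral_winning B A q2 q1"
    unfolding W_def by (rule bicameral_winning_commute)
  then have "critical_count (A \<union> B) W b k =
      critical_count (B \<union> A) (bicameral_winning B A q2 q1) b k"
    by (simp add: Un_commute)
  also have "\<dots> = (if q2 + q1 \<le> k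
      then ((p2 + q2 - 1) choose (q2 - 1)) * ((p1 + q1) choose (k - q2)) else 0)"
    by (subst critical_count_bicameral) (use assms in auto)
  finally have b: "critical_count (A \<union> B) W b k = (if q1 + q2 \<le> k
      then ((p2 + q2 - 1) choose (q2 - 1)) * ((p1 + q1) choose (k - q2)) else 0)"
    by (simp add: add.commute)
  show ?thesis
  proof (cases "q1 + q2 \<le> k")
    case False
    then show ?thesis using a b by simp
  next
    case True
    then obtain j where k: "k = q1 + q2 + j" by (auto simp: le_iff_add)
    show ?thesis
    proof (cases "j \<le> p2")
      case True
      then show ?thesis
        using binomial_product_less[OF q less True] a b by (simp add: k)
    next
      case False
      \<comment> \<open>Since \<open>p1 < p2 < j\<close>, the second binomial in each product is
        0.\<close>
      have "q1 * p1 \<le> q2 * p1" using q by simp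
      then have "p1 < p2" using less by (metis le_less_trans mult_less_cancel1)
      then show ?thesis using False a b by (simp add: k binomial_eq_0)
    qed
  qed
qed

text \<open>The sums compare termwise. A strict term needs a size with nonzero weight at which
  \<open>s\<close> is critical somewhere; without one, \<open>dom\<close> would make both powers
  0.\<close>

lemma power_index_less:
  assumes dom: "\<And>k. critical_count N W r k < critical_count N W s k \<or>
      critical_count N W r k = 0 \<and> critical_count N W s k = 0"
    and w: "weighting_vector (card N) w"
    and nz: "\<not> (power_index w N W s = 0 \<and> power_index w N W r = 0)"
  shows "power_index w N W r < power_index w N W s"
proof -
  have w0: "0 \<le> w k" if "k \<in> {1..card N}" for k
    using w that unfolding weighting_vector_def by blast
  have "\<exists>k\<in>{1..card N}. w k \<noteq> 0 \<and> critical_count N W s k \<noteq> 0"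
  proof (rule ccontr)
    assume "\<not> ?thesis"
    then have "w k * real (critical_count N W s k) = 0" "w k * real (critical_count N W r k) = 0"
      if "k \<in> {1..card N}" for k
      using that dom[of k] by auto
    then show False
      using nz unfolding power_index_def by (simp add: sum.neutral)
  qed
  then obtain k where k: "k \<in> {1..card N}" "w k \<noteq> 0" "critical_count N W s k \<noteq> 0" by blast
  show ?thesis
    unfolding power_index_def
  proof (rule sum_strict_mono_ex1)
    show "\<forall>k\<in>{1..card N}. w k * real (critical_count N W r k) \<le> w k * real (critical_count N W s k)"
    proof
      fix k assume "k \<in> {1..card N}"
      then show "w k * real (critical_count N W r k) \<le> w k * real (critical_count N W s k)"
        using w0 dom[of k] by (intro mult_left_mono) auto
    qed
    have "w k * real (critical_count N W r k) < w k * real (critical_count N W s k)"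
      using w0[OF k(1)] k dom[of k] by (intro mult_strict_left_mono) auto
    then show "\<exists>k\<in>{1..card N}. w k * real (critical_count N W r k) < w k * real (critical_count N W s k)"
      using k(1) by blast
  qed simp
qed

lemma majority_quota:
  assumes "int q = \<lceil>(real m + 1) / 2\<rceil>"
  shows "q = m div 2 + 1"
proof -
  have "\<lceil>(real m + 1) / 2\<rceil> = int (m div 2 + 1)"
  proof (cases "even m")
    case True
    then obtain a where "m = 2 * a" by (rule evenE)
    then show ?thesis by (intro ceiling_unique) auto
  next
    case False
    then obtain a where "m = 2 * a + 1" by (rule oddE)
    then show ?thesis by (intro ceiling_unique) auto
  qed
  then show ?thesis using assms by linarith
qed

text \<open>With \<open>a\<close>, \<open>b\<close> the halves of \<open>m\<^sub>s\<close>,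
  \<open>m\<^sub>r\<close> rounded down, the claim reduces to \<open>a < b\<close> when the parities
  agree, to \<open>a < 2 * b + 1\<close> for even \<open>m\<^sub>s\<close> and odd
  \<open>m\<^sub>r\<close>, and to \<open>2 * a + 1 < b\<close> in the last case, which is exactly
  \<open>m\<^sub>r > 2 * m\<^sub>s\<close>.\<close>

lemma majority_quota_less:
  fixes m\<^sub>s m\<^sub>r :: nat
  assumes "0 < m\<^sub>s" and "m\<^sub>s < m\<^sub>r"
    and "(odd m\<^sub>s \<and> odd m\<^sub>r) \<or> (even m\<^sub>s \<and> even m\<^sub>r) \<or> (even m\<^sub>s \<and> odd m\<^sub>r) \<or>
         (odd m\<^sub>s \<and> even m\<^sub>r \<and> m\<^sub>r > 2 * m\<^sub>s)"
  shows "(m\<^sub>r div 2 + 1) * (m\<^sub>s - (m\<^sub>s div 2 + 1)) < (m\<^sub>s div 2 + 1) * (m\<^sub>r - (m\<^sub>r div 2 + 1))"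
  using assms(3)
proof (elim disjE conjE)
  assume "odd m\<^sub>s" "odd m\<^sub>r"
  then obtain a b where "m\<^sub>s = 2 * a + 1" "m\<^sub>r = 2 * b + 1" by (meson oddE)
  then show ?thesis using assms(1,2) by simp
next
  assume "even m\<^sub>s" "even m\<^sub>r"
  then obtain a b where m: "m\<^sub>s = 2 * a" "m\<^sub>r = 2 * b" by (meson evenE)
  \<comment> \<open>For even \<open>m\<close> the surplus over the quota is half of \<open>m\<close>
    minus 1; writing the half as a successor removes the truncated subtraction.\<close>
  moreover obtain a' b' where "a = Suc a'" "b = Suc b'"
    using m assms(1,2) by (cases a; cases b) auto
  ultimately show ?thesis using assms(1,2) by simp
next
  assume "even m\<^sub>s" "odd m\<^sub>r"
  then obtain a b where m: "m\<^sub>s = 2 * a" "m\<^sub>r = 2 * b + 1" by (meson evenE oddE)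
  moreover obtain a' where "a = Suc a'"
    using m assms(1,2) by (cases a) auto
  ultimately show ?thesis using assms(1,2) by simp
next
  assume "odd m\<^sub>s" "even m\<^sub>r" "m\<^sub>r > 2 * m\<^sub>s"
  then obtain a b where m: "m\<^sub>s = 2 * a + 1" "m\<^sub>r = 2 * b" by (meson evenE oddE)
  moreover obtain b' where "b = Suc b'"
    using m assms(1,2) by (cases b) auto
  ultimately show ?thesis using \<open>m\<^sub>r > 2 * m\<^sub>s\<close> by simp
qed

theorem theorem1:
  fixes Sen Rep :: "'a set" and m\<^sub>s m\<^sub>r q\<^sub>s q\<^sub>r :: nat
  defines "N \<equiv> Sen \<union> Rep"
    and "W \<equiv> bicameral_winning Sen Rep q\<^sub>s q\<^sub>r"
  assumes "finite Sen" and "finite Rep" and "Sen \<inter> Rep = {}"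
    and "card Sen = m\<^sub>s" and "card Rep = m\<^sub>r"
    and "0 < m\<^sub>s" and "m\<^sub>s < m\<^sub>r"
    and "int q\<^sub>s = \<lceil>(real m\<^sub>s + 1) / 2\<rceil>" and "int q\<^sub>r = \<lceil>(real m\<^sub>r + 1) / 2\<rceil>"
    and "(odd m\<^sub>s \<and> odd m\<^sub>r) \<or> (even m\<^sub>s \<and> even m\<^sub>r) \<or> (even m\<^sub>s \<and> odd m\<^sub>r) \<or>
         (odd m\<^sub>s \<and> even m\<^sub>r \<and> m\<^sub>r > 2 * m\<^sub>s)"
  shows "\<forall>s\<in>Sen. \<forall>r\<in>Rep.
           (\<forall>k. critical_count N W s k \<noteq> 0 \<longrightarrow> critical_count N W s k > critical_count N W r k) \<and>
           (\<forall>w. weighting_vector (card N) w \<longrightarrow>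
                \<not> (power_index w N W s = 0 \<and> power_index w N W r = 0) \<longrightarrow>
                power_index w N W s > power_index w N W r)"
proof (intro ballI)
  fix s r assume s: "s \<in> Sen" and r: "r \<in> Rep"
  have q: "q\<^sub>s = m\<^sub>s div 2 + 1" "q\<^sub>r = m\<^sub>r div 2 + 1"
    using assms majority_quota by blast+
  have "q\<^sub>r * (m\<^sub>s - q\<^sub>s) < q\<^sub>s * (m\<^sub>r - q\<^sub>r)"
    unfolding q using assms by (intro majority_quota_less)
  \<comment> \<open>Each quota is at most the size of its chamber, so \<open>m - q\<close> is a true
    surplus and can serve as \<open>p1\<close> or \<open>p2\<close>.\<close>
  moreover have "card Sen = (m\<^sub>s - q\<^sub>s) + q\<^sub>s" "card Rep = (m\<^sub>r - q\<^sub>r) + q\<^sub>r"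
    using assms q by auto
  moreover have "0 < q\<^sub>s" "q\<^sub>s \<le> q\<^sub>r"
    using assms q by (auto intro: div_le_mono)
  ultimately have dom: "critical_count N W r k < critical_count N W s k \<or>
      critical_count N W r k = 0 \<and> critical_count N W s k = 0" for k
    unfolding N_def W_def using s r assms by (intro critical_count_bicameral_less) auto
  show "(\<forall>k. critical_count N W s k \<noteq> 0 \<longrightarrow> critical_count N W s k > critical_count N W r k) \<and>
      (\<forall>w. weighting_vector (card N) w \<longrightarrow>
        \<not> (power_index w N W s = 0 \<and> power_index w N W r = 0) \<longrightarrow>
        power_index w N W s > power_index w N W r)"
  proof (intro conjI allI impI)
    show "critical_count N W s k > critical_count N W r k" if "critical_count N W s k \<noteq> 0" for k
      using dom[of k] that by simp
  qed (rule power_index_less[OF dom])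
qed

end
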